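(* Let $n\ge2$, $r\ge1$, $0\le\beta<\infty$, $p_1,\dots,p_n\in\mathbb{R}$, $\omega_1,\dots,\omega_r\in\mathbb{R}$, and let $a_1,\dots,a_r\ge0$ with $\sum_\ell a_\ell=1$. Let $$W^\star_{ij}=\exp\bigl(\beta K_a(p_i-p_j)\bigr),\quad K_a(h)=\sum_{\ell=1}^{r}a_\ell\cos(\omega_\ell h),\quad A^\star_{ij}=\frac{W^\star_{ij}}{\sum_kW^\star_{ik}},$$ and let $\gamma=1-\lambda_2(A^\star)$. Then $$\operatorname{spec}(A^\star)\subset[0,1],\qquad 0<\gamma\le1.$$ If $\beta=0$, then $\gamma=1$. If $\beta>0$, equality $\gamma=1$ holds if and only if every active plane is invisible on the sampled positions, i.e. $$a_\ell>0\ \Longrightarrow\ \omega_\ell(p_i-p_j)\in2\pi\mathbb{Z}\ \text{ for all }i,j .$$ If $\beta>0$ and at least one active plane is visible (there is $\ell$ with $a_\ell>0$ and some $i,j$ with $\omega_\ell(p_i-p_j)\notin2\pi\mathbb{Z}$), then $0<\gamma<1$.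
   Context: Eigenvalues of $A^\star$ are real and ordered non-increasingly with multiplicity, $\lambda_1(A^\star)\ge\lambda_2(A^\star)\ge\cdots\ge\lambda_n(A^\star)$. $A^\star$ is the attention matrix at a consensus state $x^\star\in\mathbb{S}^{2r-1}$ of rotary self-attention, $a_\ell$ being the squared norm of the component of $x^\star$ in the $\ell$-th rotation plane; a plane $\ell$ is active if $a_\ell>0$. *)

theory Defs
  imports
    "Jordan_Normal_Form.Spectral_Radius"
    "HOL-Computational_Algebra.Fundamental_Theorem_Algebra"
begin

text \<open>
  The index sets of positions and of rotation planes are \<open>{..<n}\<close> and \<open>{..<r}\<close>;
  the values of \<open>p\<close>, \<open>\<omega>\<close>, \<open>a\<close> outside these sets are irrelevant.
\<close>

definition rotary_kernel :: "nat \<Rightarrow> (nat \<Rightarrow> real) \<Rightarrow> (nat \<Rightarrow> real) \<Rightarrow> real \<Rightarrow> real" where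
  "rotary_kernel r \<omega> a h = (\<Sum>l<r. a l * cos (\<omega> l * h))"

definition attention_weight ::
    "nat \<Rightarrow> real \<Rightarrow> (nat \<Rightarrow> real) \<Rightarrow> (nat \<Rightarrow> real) \<Rightarrow> (nat \<Rightarrow> real) \<Rightarrow> nat \<Rightarrow> nat \<Rightarrow> real" where
  "attention_weight r \<beta> p \<omega> a i j = exp (\<beta> * rotary_kernel r \<omega> a (p i - p j))"

definition attention_matrix ::
    "nat \<Rightarrow> nat \<Rightarrow> real \<Rightarrow> (nat \<Rightarrow> real) \<Rightarrow> (nat \<Rightarrow> real) \<Rightarrow> (nat \<Rightarrow> real) \<Rightarrow> real mat" where
  "attention_matrix n r \<beta> p \<omega> a =
     mat n n (\<lambda>(i, j). attention_weight r \<beta> p \<omega> a i j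
                        / (\<Sum>k<n. attention_weight r \<beta> p \<omega> a i k))"

text \<open>
  The real eigenvalues in non-increasing order, each repeated according to its multiplicity
  as a root of the characteristic polynomial. The list has as many entries as the matrix
  has rows whenever all complex eigenvalues are real
  (see \<open>length_eigenvalue_list\<close> below).
\<close>

definition eigenvalue_list :: "real mat \<Rightarrow> real list" where
  "eigenvalue_list A = rev (sorted_list_of_multiset (proots (char_poly A)))"

text \<open>The \<open>k\<close>-th largest eigenvalue, counted from \<open>k = 1\<close>.\<close>

definition nth_eigenvalue :: "nat \<Rightarrow> real mat \<Rightarrow> real" where
  "nth_eigenvalue k A = eigenvalue_list A ! (k - 1)"

text \<open>The spectrum in the complex plane, so that non-real eigenvalues are not overlooked.\<close>

definition complex_spectrum :: "real mat \<Rightarrow> complex set" where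
  "complex_spectrum A = spectrum (map_mat complex_of_real A)"

definition spectral_gap :: "real mat \<Rightarrow> real" where
  "spectral_gap A = 1 - nth_eigenvalue 2 A"

definition two_pi_ints :: "real set" where
  "two_pi_ints = range (\<lambda>k::int. 2 * pi * of_int k)"

lemma map_poly_of_real_split:
  fixes p :: "real poly"
  assumes "p \<noteq> 0" and "\<And>z. poly (map_poly complex_of_real p) z = 0 \<Longrightarrow> z \<in> \<real>"
  shows "size (proots p) = degree p"
  using assms
proof (induction "degree p" arbitrary: p rule: less_induct)
  case less
  interpret cr: map_poly_inj_idom_hom complex_of_real ..
  show ?case
  proof (cases "degree p = 0")
    case True
    then show ?thesis by (metis degree_eq_zeroE proots_const size_empty)
  next
    case False
    then have "degree (map_poly complex_of_real p) \<noteq> 0" by simp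
    then have "\<not> constant (poly (map_poly complex_of_real p))" by (simp add: constant_degree)
    then obtain z where z: "poly (map_poly complex_of_real p) z = 0"
      using fundamental_theorem_of_algebra by blast
    with less.prems obtain x where x: "z = complex_of_real x" by (auto elim: Reals_cases)
    have "complex_of_real (poly p x) = 0" using z x by simp
    then have "poly p x = 0" by simp
    then obtain q where q: "p = [:- x, 1:] * q" by (auto simp: poly_eq_0_iff_dvd elim: dvdE)
    have q0: "q \<noteq> 0" using q less.prems by auto
    have deg: "degree p = Suc (degree q)" unfolding q using q0 by (subst degree_mult_eq) auto
    have "size (proots q) = degree q"
    proof (rule less.hyps)
      show "degree q < degree p" using deg by simp
      show "q \<noteq> 0" by (fact q0)
      show "w \<in> \<real>" if "poly (map_poly complex_of_real q) w = 0" for w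
        by (rule less.prems(2)) (simp add: q cr.hom_mult that del: mult_pCons_left)
    qed
    moreover have "proots p = proots [:- x, 1:] + proots q"
      unfolding q using q0 by (intro proots_mult) auto
    ultimately show ?thesis by (simp add: deg)
  qed
qed

lemma length_eigenvalue_list:
  assumes A: "A \<in> carrier_mat n n" and "complex_spectrum A \<subseteq> \<real>"
  shows "length (eigenvalue_list A) = n"
proof -
  have cA: "map_mat complex_of_real A \<in> carrier_mat n n" using A by simp
  have deg: "degree (char_poly A) = n" and nz: "char_poly A \<noteq> 0"
    using degree_monic_char_poly[OF A] by auto
  have "size (proots (char_poly A)) = degree (char_poly A)"
  proof (rule map_poly_of_real_split[OF nz])
    fix z assume "poly (map_poly complex_of_real (char_poly A)) z = 0"
    then have "eigenvalue (map_mat complex_of_real A) z"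
      by (simp add: eigenvalue_root_char_poly[OF cA] of_real_hom.char_poly_hom[OF A])
    then show "z \<in> \<real>" using assms(2) by (auto simp: complex_spectrum_def spectrum_def)
  qed
  then show ?thesis
    by (metis deg eigenvalue_list_def length_rev mset_sorted_list_of_multiset size_mset)
qed

end

theory Submission
  imports Defs
begin

text \<open>
  Write \<open>A = D\<^sup>-\<^sup>1 W\<close>, where \<open>W\<close> is symmetric with positive entries and \<open>D\<close> is the diagonal matrix
  of its row sums. The powers \<open>K\<^sup>k\<close> of the rotary kernel are positive semidefinite by the addition
  theorem of the cosine, hence so is \<open>W = exp (\<beta> K)\<close> by its power series (\<open>attention_weight_psd\<close>).
  An eigenvalue of \<open>A\<close> with eigenvector \<open>v\<close> is the quotient of \<open>v\<^sup>* W v \<ge> 0\<close> and \<open>v\<^sup>* D v > 0\<close>,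
  and its modulus is at most one because \<open>A\<close> is stochastic; this puts the spectrum into \<open>[0, 1]\<close>.

  The largest eigenvalue is 1. That the second one is smaller is a statement about the algebraic
  multiplicity of 1. It is read off from a triangular form \<open>A P = P B\<close> whose diagonal is the ordered
  list of eigenvalues: if 1 came twice, both of the first two columns of \<open>P\<close> would be constant vectors,
  since positive stochastic matrices average strictly, and \<open>P\<close> would be singular
  (\<open>positive_stochastic_second_eigenvalue_neq_1\<close>).

  The equality case is decided by the trace. All eigenvalues are nonnegative, so \<open>\<lambda>\<^sub>2 = 0\<close> exactly
  when they sum to 1, that is, when \<open>A\<close> has trace 1. As \<open>K\<close> is largest at 0, the diagonal entry of
  each row of \<open>W\<close> is a maximum of the row, so every diagonal entry of \<open>A\<close> is at least \<open>1/n\<close>.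
  Trace 1 thus means that every row of \<open>W\<close> is constant (\<open>second_eigenvalue_eq_0_iff\<close>). For
  \<open>\<beta> > 0\<close> this says \<open>K (p\<^sub>i - p\<^sub>j) = 1\<close>; a convex combination of cosines equals 1 only if every
  cosine of positive weight does, which is invisibility of the active planes.
\<close>

section \<open>Characteristic polynomials that split\<close>

text \<open>
  As many roots as the degree leave no room for a further, rootless factor.
\<close>

lemma monic_eq_prod_proots:
  fixes p :: "'a :: field poly"
  assumes "lead_coeff p = 1" and "size (proots p) = degree p"
  shows "p = (\<Prod>x\<in>#proots p. [:- x, 1:])"
  using assms
proof (induction "degree p" arbitrary: p)
  case 0
  then show ?case by (metis degree_0_id image_mset_empty of_nat_1 one_pCons prod_mset_empty size_eq_0_iff_empty)
next
  case (Suc d)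
  from Suc.hyps(2) Suc.prems(2) obtain x where x: "x \<in># proots p"
    by (metis multiset_nonemptyE nat.distinct(1) size_empty)
  have p0: "p \<noteq> 0" using Suc.prems(1) by auto
  from x p0 obtain q where q: "p = [:- x, 1:] * q"
    by (auto simp: poly_eq_0_iff_dvd elim: dvdE)
  have q0: "q \<noteq> 0" using q p0 by auto
  have dq: "degree p = Suc (degree q)" unfolding q using q0 by (subst degree_mult_eq) auto
  have pr: "proots p = add_mset x (proots q)"
    unfolding q using q0 by (subst proots_mult) auto
  have "lead_coeff q = 1" using Suc.prems(1) unfolding q by (simp only: lead_coeff_mult) simp
  then have "q = (\<Prod>x\<in>#proots q. [:- x, 1:])"
    using Suc.hyps Suc.prems(2) dq pr by auto
  then show ?case using q pr by (metis image_mset_add_mset prod_mset.add_mset)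
qed

lemma char_poly_eq_prod_eigenvalue_list:
  assumes A: "A \<in> carrier_mat n n" and real: "complex_spectrum A \<subseteq> \<real>"
  shows "char_poly A = (\<Prod>e\<leftarrow>eigenvalue_list A. [:- e, 1:])"
proof -
  have ms: "mset (eigenvalue_list A) = proots (char_poly A)"
    by (simp add: eigenvalue_list_def)
  have "size (proots (char_poly A)) = degree (char_poly A)"
    using length_eigenvalue_list[OF A real] degree_monic_char_poly[OF A] ms
    by (metis size_mset)
  then have "char_poly A = (\<Prod>e\<in>#proots (char_poly A). [:- e, 1:])"
    using degree_monic_char_poly[OF A] by (intro monic_eq_prod_proots) auto
  also have "\<dots> = (\<Prod>e\<leftarrow>eigenvalue_list A. [:- e, 1:])"
    by (simp flip: ms mset_map add: prod_mset_prod_list)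
  finally show ?thesis .
qed

lemma set_eigenvalue_list:
  assumes "A \<in> carrier_mat n n"
  shows "set (eigenvalue_list A) = {x. eigenvalue A x}"
proof -
  have "set (eigenvalue_list A) = set_mset (proots (char_poly A))"
    by (simp add: eigenvalue_list_def)
  also have "\<dots> = {x. poly (char_poly A) x = 0}"
    using degree_monic_char_poly[OF assms] by (subst set_count_proots) auto
  finally show ?thesis using eigenvalue_root_char_poly[OF assms] by simp
qed

lemma sorted_eigenvalue_list: "sorted_wrt (\<ge>) (eigenvalue_list A)"
  by (simp add: eigenvalue_list_def sorted_wrt_rev)

text \<open>
  The Schur decomposition lets the order of the diagonal entries be prescribed, so the ordered
  eigenvalues with their algebraic multiplicities become visible on the diagonal of a triangular
  matrix. Both the trace formula and the simplicity of the eigenvalue 1 are read off from it.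
\<close>

lemma triangular_form_eigenvalue_list:
  assumes A: "A \<in> carrier_mat n n" and real: "complex_spectrum A \<subseteq> \<real>"
  obtains B P Q where "similar_mat_wit A B P Q" "upper_triangular B"
    "diag_mat B = eigenvalue_list A"
  using schur_decomposition[OF A char_poly_eq_prod_eigenvalue_list[OF A real]]
  by (cases "schur_decomposition A (eigenvalue_list A)") blast

lemma index_mult_mat_sum:
  assumes "A \<in> carrier_mat n m" "B \<in> carrier_mat m k" "i < n" "j < k"
  shows "(A * B) $$ (i, j) = (\<Sum>l<m. A $$ (i, l) * B $$ (l, j))"
  using assms by (auto simp: scalar_prod_def atLeast0LessThan intro!: sum.cong)

lemma trace_mult_commute:
  fixes A B :: "'a :: comm_ring_1 mat"
  assumes "A \<in> carrier_mat n n" "B \<in> carrier_mat n n"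
  shows "(\<Sum>i<n. (A * B) $$ (i, i)) = (\<Sum>i<n. (B * A) $$ (i, i))"
proof -
  have "(\<Sum>i<n. (A * B) $$ (i, i)) = (\<Sum>i<n. \<Sum>l<n. A $$ (i, l) * B $$ (l, i))"
    using assms by (intro sum.cong) (auto simp: index_mult_mat_sum[of _ n n _ n] simp del: index_mult_mat)
  also have "\<dots> = (\<Sum>l<n. \<Sum>i<n. B $$ (l, i) * A $$ (i, l))"
    by (subst sum.swap) (simp add: mult.commute)
  also have "\<dots> = (\<Sum>i<n. (B * A) $$ (i, i))"
    using assms by (intro sum.cong) (auto simp: index_mult_mat_sum[of _ n n _ n] simp del: index_mult_mat)
  finally show ?thesis .
qed

lemma sum_eigenvalue_list:
  assumes A: "A \<in> carrier_mat n n" and real: "complex_spectrum A \<subseteq> \<real>"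
  shows "sum_list (eigenvalue_list A) = (\<Sum>i<n. A $$ (i, i))"
proof -
  obtain B P Q where w: "similar_mat_wit A B P Q" and d: "diag_mat B = eigenvalue_list A"
    using triangular_form_eigenvalue_list[OF A real] .
  note w = similar_mat_witD2[OF A w]
  have "A = P * (B * Q)" using w by simp
  then have "(\<Sum>i<n. A $$ (i, i)) = (\<Sum>i<n. ((B * Q) * P) $$ (i, i))"
    using trace_mult_commute[of P n "B * Q"] w by simp
  also have "(B * Q) * P = B"
    using w by (subst assoc_mult_mat[of _ n n _ n _ n]) auto
  also have "(\<Sum>i<n. B $$ (i, i)) = sum_list (diag_mat B)"
    using w by (simp add: diag_mat_def sum_list_distinct_conv_sum_set atLeast0LessThan)
  finally show ?thesis using d by simp
qed

section \<open>Positive stochastic matrices\<close>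

lemma ex_maximal_index:
  fixes f :: "nat \<Rightarrow> real"
  assumes "0 < n"
  obtains m where "m < n" "\<And>j. j < n \<Longrightarrow> f j \<le> f m"
proof -
  have "Max (f ` {..<n}) \<in> f ` {..<n}" using assms by (intro Max_in) auto
  then obtain m where m: "m < n" "f m = Max (f ` {..<n})" by auto
  have "f j \<le> f m" if "j < n" for j unfolding m(2) using that by (intro Max_ge) auto
  with m(1) show thesis by (rule that)
qed

text \<open>
  An average of \<open>v\<close> cannot exceed its maximum nor fall below its minimum, so looking at a row where
  \<open>v\<close> is maximal and at one where it is minimal forces \<open>c = 0\<close>; then at a maximum the average with
  positive weights reaches the maximum only if \<open>v\<close> is constant. The shift \<open>c\<close> makes the lemma
  cover generalised eigenvectors for the eigenvalue 1 too: these satisfy such an equation as soon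
  as the true eigenvectors are constant.
\<close>

lemma stochastic_shift_imp_constant:
  fixes M :: "nat \<Rightarrow> nat \<Rightarrow> real"
  assumes pos: "\<And>i j. i < n \<Longrightarrow> j < n \<Longrightarrow> M i j > 0"
    and stoch: "\<And>i. i < n \<Longrightarrow> (\<Sum>j<n. M i j) = 1"
    and shift: "\<And>i. i < n \<Longrightarrow> (\<Sum>j<n. M i j * v j) = v i + c"
    and ij: "i < n" "j < n"
  shows "v i = v j"
proof -
  have "0 < n" using ij by simp
  obtain m where m: "m < n" "\<And>j. j < n \<Longrightarrow> v j \<le> v m"
    using ex_maximal_index[OF \<open>0 < n\<close>] by blast
  obtain k where k: "k < n" "\<And>j. j < n \<Longrightarrow> v k \<le> v j"
    using ex_maximal_index[OF \<open>0 < n\<close>, of "\<lambda>j. - v j"] by (metis neg_le_iff_le)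
  have dev: "(\<Sum>j<n. M i j * (v i - v j)) = - c" if "i < n" for i
    using shift[OF that] stoch[OF that]
    by (simp add: right_diff_distrib sum_subtractf flip: sum_distrib_right)
  have "0 \<le> (\<Sum>j<n. M m j * (v m - v j))"
    using m pos by (intro sum_nonneg) (simp add: less_imp_le)
  moreover have "0 \<le> (\<Sum>j<n. M k j * (v j - v k))"
    using k pos by (intro sum_nonneg) (simp add: less_imp_le)
  moreover have "(\<Sum>j<n. M k j * (v j - v k)) = - (\<Sum>j<n. M k j * (v k - v j))"
    by (simp add: algebra_simps flip: sum_negf)
  ultimately have "c = 0" using dev[OF m(1)] dev[OF k(1)] by simp
  then have zero: "(\<Sum>j<n. M m j * (v m - v j)) = 0" using dev m by simp
  have "M m j * (v m - v j) = 0" if "j < n" for j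
    using zero m pos that by (subst (asm) sum_nonneg_eq_0_iff) (auto simp: less_imp_le)
  then have "v m = v j" if "j < n" for j using pos[OF m(1) that] that by fastforce
  then show ?thesis using ij by metis
qed

lemma complex_eigenvalueE:
  assumes "A \<in> carrier_mat n n" "\<mu> \<in> complex_spectrum A"
  obtains v i where "i < n" "v i \<noteq> 0"
    "\<And>i. i < n \<Longrightarrow> (\<Sum>j<n. of_real (A $$ (i, j)) * v j) = \<mu> * v i"
proof -
  let ?C = "map_mat complex_of_real A"
  from assms obtain u where u: "u \<in> carrier_vec n" "u \<noteq> 0\<^sub>v n" "?C *\<^sub>v u = \<mu> \<cdot>\<^sub>v u"
    by (auto simp: complex_spectrum_def spectrum_def eigenvalue_def eigenvector_def)
  from u obtain i where "i < n" "u $ i \<noteq> 0" by (metis carrier_vecD eq_vecI index_zero_vec)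
  moreover have "(\<Sum>j<n. of_real (A $$ (i, j)) * u $ j) = \<mu> * u $ i" if "i < n" for i
  proof -
    have "(\<Sum>j<n. of_real (A $$ (i, j)) * u $ j) = (?C *\<^sub>v u) $ i"
      using that assms(1) u(1) by (auto simp: scalar_prod_def atLeast0LessThan intro!: sum.cong)
    then show ?thesis using u that by simp
  qed
  ultimately show thesis by (rule that)
qed

text \<open>
  Compare both sides of the eigenvalue equation in a row where the eigenvector has maximal modulus.
\<close>

lemma stochastic_eigenvalue_norm_le_1:
  assumes A: "A \<in> carrier_mat n n"
    and nonneg: "\<And>i j. i < n \<Longrightarrow> j < n \<Longrightarrow> A $$ (i, j) \<ge> 0"
    and stoch: "\<And>i. i < n \<Longrightarrow> (\<Sum>j<n. A $$ (i, j)) = 1"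
    and ev: "\<mu> \<in> complex_spectrum A"
  shows "norm \<mu> \<le> 1"
proof -
  obtain v i where i: "i < n" "v i \<noteq> 0"
    and v: "\<And>i. i < n \<Longrightarrow> (\<Sum>j<n. of_real (A $$ (i, j)) * v j) = \<mu> * v i"
    using complex_eigenvalueE[OF A ev] by metis
  have "0 < n" using i by simp
  then obtain m where m: "m < n" "\<And>j. j < n \<Longrightarrow> norm (v j) \<le> norm (v m)"
    using ex_maximal_index[of n "\<lambda>j. norm (v j)"] by blast
  have "norm \<mu> * norm (v m) = norm (\<Sum>j<n. of_real (A $$ (m, j)) * v j)"
    using v[OF m(1)] by (simp add: norm_mult)
  also have "\<dots> \<le> (\<Sum>j<n. A $$ (m, j) * norm (v m))"
    using m nonneg by (intro sum_norm_le) (simp add: norm_mult mult_left_mono)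
  also have "\<dots> = norm (v m)" using stoch[OF m(1)] by (simp flip: sum_distrib_right)
  finally have "norm \<mu> * norm (v m) \<le> 1 * norm (v m)" by simp
  moreover have "norm (v m) > 0" using m(2)[OF i(1)] i(2) by (metis norm_le_zero_iff not_le order_trans)
  ultimately show ?thesis by (simp only: mult_le_cancel_right_pos)
qed

text \<open>
  This excludes a double root 1 of the characteristic polynomial, not only a two-dimensional
  eigenspace. In the triangular form \<open>A P = P B\<close> with \<open>B\<^sub>0\<^sub>0 = B\<^sub>1\<^sub>1 = 1\<close>, column 0 of \<open>P\<close> is fixed
  by \<open>A\<close>, hence constant; column 1 is then reproduced by \<open>A\<close> up to a constant shift, hence constant
  as well. Two constant columns contradict the invertibility of \<open>P\<close>.
\<close>

lemma positive_stochastic_second_eigenvalue_neq_1: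
  assumes n: "n \<ge> 2" and A: "A \<in> carrier_mat n n"
    and pos: "\<And>i j. i < n \<Longrightarrow> j < n \<Longrightarrow> A $$ (i, j) > 0"
    and stoch: "\<And>i. i < n \<Longrightarrow> (\<Sum>j<n. A $$ (i, j)) = 1"
    and real: "complex_spectrum A \<subseteq> \<real>"
    and first: "eigenvalue_list A ! 0 = 1"
  shows "eigenvalue_list A ! 1 \<noteq> 1"
proof
  assume second: "eigenvalue_list A ! 1 = 1"
  obtain B P Q where w: "similar_mat_wit A B P Q" and tri: "upper_triangular B"
    and d: "diag_mat B = eigenvalue_list A"
    using triangular_form_eigenvalue_list[OF A real] .
  note w = similar_mat_witD2[OF A w]
  have B00: "B $$ (0, 0) = 1" and B11: "B $$ (1, 1) = 1"
    using first second d n w(5) by (auto simp flip: d simp: diag_mat_def)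
  have B10: "B $$ (i, j) = 0" if "j < i" "i < n" for i j
    using tri w(5) that by auto
  have "A * P = P * B * (Q * P)"
    unfolding w(3) using w(5-7) by (intro assoc_mult_mat) auto
  then have AP: "A * P = P * B" using w by simp
  have col: "(\<Sum>l<n. A $$ (i, l) * P $$ (l, j)) = (\<Sum>l<n. P $$ (i, l) * B $$ (l, j))"
    if "i < n" "j < n" for i j
    using arg_cong[OF AP, of "\<lambda>M. M $$ (i, j)"] that w
    by (simp add: index_mult_mat_sum[of _ n n _ n] del: index_mult_mat)
  have split2: "(\<Sum>l<n. f l) = f 0 + f 1" if "\<And>l. 1 < l \<Longrightarrow> l < n \<Longrightarrow> f l = 0" for f :: "nat \<Rightarrow> real"
  proof -
    have "(\<Sum>l<n. f l) = sum f {0, 1}"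
      using n that by (intro sum.mono_neutral_right) (auto simp: not_less_eq less_Suc_eq_0_disj)
    then show ?thesis by simp
  qed
  \<comment> \<open>Below row 1 the first two columns of \<open>B\<close> vanish, so only the first two columns of \<open>P\<close> enter.\<close>
  have PB: "(\<Sum>l<n. P $$ (i, l) * B $$ (l, j)) = P $$ (i, 0) * B $$ (0, j) + P $$ (i, 1) * B $$ (1, j)"
    if "j < 2" for i j
    using that B10 by (intro split2) auto
  have col0: "(\<Sum>l<n. A $$ (i, l) * P $$ (l, 0)) = P $$ (i, 0) + 0" if "i < n" for i
    using col[OF that, of 0] PB[of 0 i] n B10[of 0 1] B00 by simp
  have const0: "P $$ (i, 0) = P $$ (0, 0)" if "i < n" for i
    using stochastic_shift_imp_constant[of n "\<lambda>i j. A $$ (i, j)" "\<lambda>i. P $$ (i, 0)" 0 i 0]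
      pos stoch col0 that n by simp
  have col1: "(\<Sum>l<n. A $$ (i, l) * P $$ (l, 1)) = P $$ (i, 1) + P $$ (0, 0) * B $$ (0, 1)"
    if "i < n" for i
    using col[OF that, of 1] PB[of 1 i] n B11 const0[OF that] by simp
  have const1: "P $$ (i, 1) = P $$ (0, 1)" if "i < n" for i
    using stochastic_shift_imp_constant[of n "\<lambda>i j. A $$ (i, j)" "\<lambda>i. P $$ (i, 1)" _ i 0]
      pos stoch col1 that n by simp
  have QP: "(\<Sum>l<n. Q $$ (i, l)) * P $$ (0, j) = (if i = j then 1 else 0)" if "i < 2" "j < 2" for i j
  proof -
    have Pc: "P $$ (l, j) = P $$ (0, j)" if "l < n" for l
      using const0[OF that] const1[OF that] \<open>j < 2\<close> by (auto simp: less_2_cases_iff)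
    have "(Q * P) $$ (i, j) = (\<Sum>l<n. Q $$ (i, l) * P $$ (l, j))"
      using that n w by (intro index_mult_mat_sum[of _ n n _ n]) auto
    also have "\<dots> = (\<Sum>l<n. Q $$ (i, l)) * P $$ (0, j)"
      unfolding sum_distrib_right by (intro sum.cong refl arg_cong2[of _ _ _ _ "(*)"] Pc) simp
    finally show ?thesis using w(2) that n by simp
  qed
  \<comment> \<open>The row sums of \<open>Q\<close> and the two column constants of \<open>P\<close> multiply to the 2-by-2 identity matrix,
    but this product of a column and a row has rank at most one.\<close>
  show False using QP[of 0 0] QP[of 1 0] QP[of 1 1] by auto
qed


section \<open>Normalised positive semidefinite weights\<close>

locale psd_weights =
  fixes n :: nat and W :: "nat \<Rightarrow> nat \<Rightarrow> real"
  assumes two_le_n: "2 \<le> n"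
    and pos: "\<And>i j. i < n \<Longrightarrow> j < n \<Longrightarrow> 0 < W i j"
    and sym: "\<And>i j. i < n \<Longrightarrow> j < n \<Longrightarrow> W i j = W j i"
    and psd: "\<And>x :: nat \<Rightarrow> real. 0 \<le> (\<Sum>i<n. \<Sum>j<n. x i * x j * W i j)"
begin

definition row_sum :: "nat \<Rightarrow> real" where
  "row_sum i = (\<Sum>k<n. W i k)"

definition A :: "real mat" where
  "A = mat n n (\<lambda>(i, j). W i j / row_sum i)"

lemma A_carrier [simp]: "A \<in> carrier_mat n n"
  by (simp add: A_def)

lemma A_index: "i < n \<Longrightarrow> j < n \<Longrightarrow> A $$ (i, j) = W i j / row_sum i"
  by (simp add: A_def)

lemma row_sum_pos: "i < n \<Longrightarrow> 0 < row_sum i"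
  unfolding row_sum_def using pos by (intro sum_pos) auto

lemma A_pos: "i < n \<Longrightarrow> j < n \<Longrightarrow> 0 < A $$ (i, j)"
  by (simp add: A_index pos row_sum_pos)

lemma A_stochastic: "i < n \<Longrightarrow> (\<Sum>j<n. A $$ (i, j)) = 1"
  using row_sum_pos[of i]
  by (simp add: A_index row_sum_def flip: sum_divide_distrib)

text \<open>
  The eigenvectors are complex a priori. As \<open>W\<close> is real and symmetric, the mixed terms of real and
  imaginary parts cancel, and what remains is the form at the real part plus the form at the
  imaginary part.
\<close>

lemma complex_form_nonneg:
  fixes v :: "nat \<Rightarrow> complex"
  obtains q :: real where "0 \<le> q"
    "(\<Sum>i<n. \<Sum>j<n. cnj (v i) * (of_real (W i j) * v j)) = of_real q"
proof
  let ?T = "\<Sum>i<n. \<Sum>j<n. cnj (v i) * (of_real (W i j) * v j)"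
  let ?q = "(\<Sum>i<n. \<Sum>j<n. Re (v i) * Re (v j) * W i j)
    + (\<Sum>i<n. \<Sum>j<n. Im (v i) * Im (v j) * W i j)"
  show "0 \<le> ?q" by (intro add_nonneg_nonneg psd)
  have "(\<Sum>i<n. \<Sum>j<n. Re (v i) * Im (v j) * W i j) = (\<Sum>j<n. \<Sum>i<n. Re (v i) * Im (v j) * W i j)"
    by (rule sum.swap)
  also have "\<dots> = (\<Sum>i<n. \<Sum>j<n. Im (v i) * Re (v j) * W i j)"
    using sym by (intro sum.cong) auto
  finally have "Im ?T = 0"
    by (simp add: algebra_simps sum.distrib sum_subtractf)
  moreover have "Re ?T = ?q"
    by (simp add: algebra_simps sum.distrib)
  ultimately show "?T = of_real ?q" by (simp add: complex_eq_iff)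
qed

text \<open>
  Multiplying the eigenvalue equation of \<open>A\<close> by the row sums turns it into \<open>W v = \<mu> D v\<close>. Pairing it
  with \<open>v\<close> exhibits \<open>\<mu>\<close> as a nonnegative real quotient \<open>q / S\<close>, and the bound on its modulus does
  the rest.
\<close>

lemma complex_spectrum_subset: "complex_spectrum A \<subseteq> complex_of_real ` {0..1}"
proof
  fix \<mu> assume ev: "\<mu> \<in> complex_spectrum A"
  obtain v m where m: "m < n" "v m \<noteq> 0"
    and v: "\<And>i. i < n \<Longrightarrow> (\<Sum>j<n. of_real (A $$ (i, j)) * v j) = \<mu> * v i"
    using complex_eigenvalueE[OF A_carrier ev] by metis
  have Wv: "(\<Sum>j<n. of_real (W i j) * v j) = \<mu> * of_real (row_sum i) * v i" if "i < n" for i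
  proof -
    have "(\<Sum>j<n. of_real (W i j) * v j)
        = (\<Sum>j<n. of_real (row_sum i) * (of_real (A $$ (i, j)) * v j))"
      using that row_sum_pos[OF that] by (intro sum.cong) (auto simp: A_index)
    also have "\<dots> = of_real (row_sum i) * (\<mu> * v i)"
      by (simp only: v[OF that] flip: sum_distrib_left)
    finally show ?thesis by (simp only: mult_ac)
  qed
  define S where "S = (\<Sum>i<n. row_sum i * (norm (v i))\<^sup>2)"
  have "0 < S" unfolding S_def
    using m row_sum_pos by (intro sum_pos2[of _ m]) (auto simp: less_imp_le)
  obtain q where q: "0 \<le> q" "(\<Sum>i<n. \<Sum>j<n. cnj (v i) * (of_real (W i j) * v j)) = of_real q"
    by (rule complex_form_nonneg)
  have "of_real q = (\<Sum>i<n. cnj (v i) * (\<mu> * of_real (row_sum i) * v i))"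
    using Wv by (simp flip: q(2) sum_distrib_left)
  also have "\<dots> = \<mu> * of_real S"
    unfolding S_def of_real_sum sum_distrib_left
    by (intro sum.cong) (simp_all only: of_real_mult complex_norm_square mult_ac)
  finally have \<mu>: "\<mu> = of_real (q / S)" using \<open>0 < S\<close> by simp
  have "norm \<mu> \<le> 1"
    using stochastic_eigenvalue_norm_le_1[OF A_carrier _ _ ev] A_pos A_stochastic by (simp add: less_imp_le)
  then have "q / S \<in> {0..1}" using q(1) \<open>0 < S\<close> by (simp add: \<mu> norm_divide)
  with \<mu> show "\<mu> \<in> complex_of_real ` {0..1}" by blast
qed

lemma complex_spectrum_real: "complex_spectrum A \<subseteq> \<real>"
  using complex_spectrum_subset by auto

lemma eigenvalue_A_bounds:
  assumes "e \<in> set (eigenvalue_list A)"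
  shows "0 \<le> e" "e \<le> 1"
proof -
  have "eigenvalue A e" using assms set_eigenvalue_list[OF A_carrier] by blast
  then have "complex_of_real e \<in> complex_spectrum A"
    by (simp add: complex_spectrum_def spectrum_def of_real_hom.char_poly_hom[of A n]
        eigenvalue_root_char_poly[of A n] eigenvalue_root_char_poly[of "map_mat complex_of_real A" n])
  then have "complex_of_real e \<in> complex_of_real ` {0..1}" using complex_spectrum_subset by blast
  then show "0 \<le> e" "e \<le> 1" by auto
qed

text \<open>
  The constant vectors have eigenvalue 1, which is also an upper bound; so it heads the list, and
  being a simple root it is not repeated.
\<close>

lemma eigenvalue_list_decomposition:
  obtains es where "eigenvalue_list A = 1 # nth_eigenvalue 2 A # es"
    "0 \<le> nth_eigenvalue 2 A" "nth_eigenvalue 2 A < 1"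
    "\<And>e. e \<in> set es \<Longrightarrow> 0 \<le> e \<and> e \<le> nth_eigenvalue 2 A"
proof -
  have "length (eigenvalue_list A) \<ge> 2"
    using length_eigenvalue_list[OF A_carrier complex_spectrum_real] two_le_n by simp
  then obtain x y es where L: "eigenvalue_list A = x # y # es"
    by (metis Suc_le_length_iff numeral_2_eq_2)
  have y: "y = nth_eigenvalue 2 A" by (simp add: nth_eigenvalue_def L)
  have "A *\<^sub>v vec n (\<lambda>_. 1) = 1 \<cdot>\<^sub>v vec n (\<lambda>_. 1)"
    using A_stochastic by (intro eq_vecI) (auto simp: scalar_prod_def A_def atLeast0LessThan)
  moreover have "vec n (\<lambda>_. 1) \<noteq> (0\<^sub>v n :: real vec)"
    using two_le_n by (auto simp: vec_eq_iff intro: exI[of _ 0])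
  ultimately have "eigenvalue A 1"
    unfolding eigenvalue_def eigenvector_def by (intro exI[of _ "vec n (\<lambda>_. 1)"]) (simp add: A_def)
  then have "1 \<in> set (eigenvalue_list A)" using set_eigenvalue_list[OF A_carrier] by blast
  then have "1 \<le> x" using sorted_eigenvalue_list[of A] by (auto simp: L)
  moreover have "x \<le> 1" using eigenvalue_A_bounds(2)[of x] by (simp add: L)
  ultimately have x: "x = 1" by simp
  have "y \<noteq> 1"
    using positive_stochastic_second_eigenvalue_neq_1[OF two_le_n A_carrier A_pos A_stochastic
        complex_spectrum_real] x by (simp add: L)
  have "0 \<le> y" "y \<le> 1" by (rule eigenvalue_A_bounds, simp add: L)+
  show thesis
  proof (rule that)
    show "eigenvalue_list A = 1 # nth_eigenvalue 2 A # es" by (simp only: L x flip: y)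
    show "0 \<le> nth_eigenvalue 2 A" "nth_eigenvalue 2 A < 1"
      using \<open>0 \<le> y\<close> \<open>y \<le> 1\<close> \<open>y \<noteq> 1\<close> unfolding y by linarith+
    show "0 \<le> e \<and> e \<le> nth_eigenvalue 2 A" if "e \<in> set es" for e
      using that eigenvalue_A_bounds(1)[of e] sorted_eigenvalue_list[of A]
      unfolding y[symmetric] L by simp
  qed
qed

lemma second_eigenvalue_bounds: "0 \<le> nth_eigenvalue 2 A" "nth_eigenvalue 2 A < 1"
proof -
  obtain es where "0 \<le> nth_eigenvalue 2 A" "nth_eigenvalue 2 A < 1"
    by (rule eigenvalue_list_decomposition)
  then show "0 \<le> nth_eigenvalue 2 A" "nth_eigenvalue 2 A < 1" by auto
qed

text \<open>
  With the eigenvalue 1 removed, the trace is 1 plus a sum of numbers that lie between 0 and the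
  second eigenvalue and include it.
\<close>

lemma second_eigenvalue_eq_0_iff_trace:
  "nth_eigenvalue 2 A = 0 \<longleftrightarrow> (\<Sum>i<n. A $$ (i, i)) = 1"
proof -
  obtain es where L: "eigenvalue_list A = 1 # nth_eigenvalue 2 A # es"
    and es: "\<And>e. e \<in> set es \<Longrightarrow> 0 \<le> e \<and> e \<le> nth_eigenvalue 2 A"
    by (rule eigenvalue_list_decomposition) blast
  have tr: "(\<Sum>i<n. A $$ (i, i)) = 1 + nth_eigenvalue 2 A + sum_list es"
    by (simp add: L flip: sum_eigenvalue_list[OF A_carrier complex_spectrum_real])
  have "0 \<le> sum_list es" using es by (intro sum_list_nonneg) auto
  moreover have "sum_list es = 0" if "nth_eigenvalue 2 A = 0"
    using es that by (subst sum_list_nonneg_eq_0_iff) (auto intro: antisym)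
  ultimately show ?thesis unfolding tr using second_eigenvalue_bounds(1) by auto
qed

text \<open>
  Since the diagonal entry dominates its row in \<open>W\<close>, it takes at least the share \<open>1/n\<close> of the row
  sum, with equality only for a constant row. The trace is therefore
  at least 1, and it equals 1 exactly when each of the \<open>n\<close> rows attains equality.
\<close>

lemma second_eigenvalue_eq_0_iff:
  assumes diag: "\<And>i j. i < n \<Longrightarrow> j < n \<Longrightarrow> W i j \<le> W i i"
  shows "nth_eigenvalue 2 A = 0 \<longleftrightarrow> (\<forall>i<n. \<forall>j<n. W i j = W i i)"
proof -
  have gap: "A $$ (i, i) - 1 / n = (\<Sum>j<n. W i i - W i j) / (n * row_sum i)" if "i < n" for i
  proof -
    have "(\<Sum>j<n. W i i - W i j) = n * W i i - row_sum i"
      by (simp add: sum_subtractf row_sum_def)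
    then show ?thesis using that row_sum_pos[OF that] by (simp add: A_index diff_divide_distrib)
  qed
  have gap_nonneg: "0 \<le> A $$ (i, i) - 1 / n" if "i < n" for i
    unfolding gap[OF that] using that diag row_sum_pos[OF that]
    by (intro divide_nonneg_nonneg sum_nonneg) auto
  have gap_eq_0: "A $$ (i, i) - 1 / n = 0 \<longleftrightarrow> (\<forall>j<n. W i j = W i i)" if "i < n" for i
  proof -
    have "A $$ (i, i) - 1 / n = 0 \<longleftrightarrow> (\<Sum>j<n. W i i - W i j) = 0"
      unfolding gap[OF that] using that row_sum_pos[OF that] by simp
    also have "\<dots> \<longleftrightarrow> (\<forall>j\<in>{..<n}. W i i - W i j = 0)"
      using that diag by (intro sum_nonneg_eq_0_iff) auto
    also have "\<dots> \<longleftrightarrow> (\<forall>j<n. W i j = W i i)"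
      by (metis lessThan_iff right_minus_eq)
    finally show ?thesis .
  qed
  have "(\<Sum>i<n. A $$ (i, i)) - 1 = (\<Sum>i<n. A $$ (i, i) - 1 / n)"
    using two_le_n by (simp add: sum_subtractf)
  then have "nth_eigenvalue 2 A = 0 \<longleftrightarrow> (\<Sum>i<n. A $$ (i, i) - 1 / n) = 0"
    unfolding second_eigenvalue_eq_0_iff_trace by linarith
  also have "\<dots> \<longleftrightarrow> (\<forall>i<n. A $$ (i, i) - 1 / n = 0)"
    using gap_nonneg by (subst sum_nonneg_eq_0_iff) auto
  also have "\<dots> \<longleftrightarrow> (\<forall>i<n. \<forall>j<n. W i j = W i i)" using gap_eq_0 by blast
  finally show ?thesis .
qed

end

section \<open>The rotary kernel\<close>

text \<open>
  Each factor \<open>cos (\<omega> (p\<^sub>i - p\<^sub>j))\<close> splits into \<open>cos (\<omega> p\<^sub>i) cos (\<omega> p\<^sub>j) + sin (\<omega> p\<^sub>i) sin (\<omega> p\<^sub>j)\<close>,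
  whose factors can be absorbed into the test vector \<open>x\<close>. A further power of the kernel therefore
  only replaces the form by a nonnegative combination of its values at other test vectors; this
  replaces the general theorem on entrywise products of positive semidefinite matrices.
\<close>

lemma rotary_kernel_power_psd:
  assumes "\<And>l. l < r \<Longrightarrow> 0 \<le> a l"
  shows "0 \<le> (\<Sum>i<n. \<Sum>j<n. x i * x j * rotary_kernel r \<omega> a (p i - p j) ^ k)"
proof (induction k arbitrary: x)
  case 0
  have "(\<Sum>i<n. \<Sum>j<n. x i * x j) = (\<Sum>i<n. x i)\<^sup>2"
    by (simp add: power2_eq_square sum_product)
  then show ?case by simp
next
  case (Suc k)
  let ?K = "\<lambda>i j. rotary_kernel r \<omega> a (p i - p j)"
  let ?c = "\<lambda>l i. x i * cos (\<omega> l * p i)" and ?s = "\<lambda>l i. x i * sin (\<omega> l * p i)"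
  have "x i * x j * ?K i j ^ Suc k
      = (\<Sum>l<r. a l * (?c l i * ?c l j * ?K i j ^ k + ?s l i * ?s l j * ?K i j ^ k))" for i j
  proof -
    have "x i * x j * ?K i j ^ Suc k = x i * x j * ?K i j ^ k * ?K i j"
      by simp
    also have "\<dots> = (\<Sum>l<r. x i * x j * ?K i j ^ k * (a l * cos (\<omega> l * (p i - p j))))"
      by (subst (2) rotary_kernel_def) (rule sum_distrib_left)
    finally show ?thesis
      by (simp add: right_diff_distrib cos_diff algebra_simps)
  qed
  then have "(\<Sum>i<n. \<Sum>j<n. x i * x j * ?K i j ^ Suc k)
      = (\<Sum>i<n. \<Sum>j<n. \<Sum>l<r. a l * (?c l i * ?c l j * ?K i j ^ k + ?s l i * ?s l j * ?K i j ^ k))"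
    by simp
  also have "\<dots> = (\<Sum>i<n. \<Sum>l<r. \<Sum>j<n. a l * (?c l i * ?c l j * ?K i j ^ k + ?s l i * ?s l j * ?K i j ^ k))"
    by (intro sum.cong refl sum.swap)
  also have "\<dots> = (\<Sum>l<r. \<Sum>i<n. \<Sum>j<n. a l * (?c l i * ?c l j * ?K i j ^ k + ?s l i * ?s l j * ?K i j ^ k))"
    by (rule sum.swap)
  also have "\<dots> = (\<Sum>l<r. a l * ((\<Sum>i<n. \<Sum>j<n. ?c l i * ?c l j * ?K i j ^ k)
      + (\<Sum>i<n. \<Sum>j<n. ?s l i * ?s l j * ?K i j ^ k)))"
    by (simp only: sum.distrib flip: sum_distrib_left)
  also have "\<dots> \<ge> 0"
    using assms by (intro sum_nonneg mult_nonneg_nonneg add_nonneg_nonneg Suc.IH) auto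
  finally show ?case .
qed

text \<open>
  Summing the exponential series entrywise writes the form of \<open>W\<close> as a series in the forms of
  the kernel powers with the nonnegative coefficients \<open>\<beta>\<^sup>k / k!\<close>.
\<close>

lemma attention_weight_psd:
  assumes "\<And>l. l < r \<Longrightarrow> 0 \<le> a l" and "0 \<le> \<beta>"
  shows "0 \<le> (\<Sum>i<n. \<Sum>j<n. x i * x j * attention_weight r \<beta> p \<omega> a i j)"
proof (rule sums_le)
  let ?K = "\<lambda>i j. rotary_kernel r \<omega> a (p i - p j)"
  show "(\<lambda>k. \<Sum>i<n. \<Sum>j<n. x i * x j * ((\<beta> * ?K i j) ^ k /\<^sub>R fact k)) sums
      (\<Sum>i<n. \<Sum>j<n. x i * x j * attention_weight r \<beta> p \<omega> a i j)"
    unfolding attention_weight_def by (intro sums_sum sums_mult exp_converges)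
  show "(\<lambda>_. 0) sums (0 :: real)" by (rule sums_zero)
  show "0 \<le> (\<Sum>i<n. \<Sum>j<n. x i * x j * ((\<beta> * ?K i j) ^ k /\<^sub>R fact k))" for k
  proof -
    have "(\<Sum>i<n. \<Sum>j<n. x i * x j * ((\<beta> * ?K i j) ^ k /\<^sub>R fact k))
        = (\<beta> ^ k / fact k) * (\<Sum>i<n. \<Sum>j<n. x i * x j * ?K i j ^ k)"
      unfolding sum_distrib_left by (intro sum.cong refl) (simp add: power_mult_distrib field_simps)
    also have "\<dots> \<ge> 0"
      using assms by (intro mult_nonneg_nonneg rotary_kernel_power_psd) auto
    finally show ?thesis .
  qed
qed

lemma cos_eq_1_iff_two_pi_ints: "cos x = 1 \<longleftrightarrow> x \<in> two_pi_ints"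
  by (auto simp: cos_one_2pi_int two_pi_ints_def mult_ac)

lemma rotary_kernel_le_1:
  assumes "\<And>l. l < r \<Longrightarrow> 0 \<le> a l" and "(\<Sum>l<r. a l) = 1"
  shows "rotary_kernel r \<omega> a h \<le> 1"
proof -
  have "rotary_kernel r \<omega> a h \<le> (\<Sum>l<r. a l * 1)"
    unfolding rotary_kernel_def using assms(1) by (intro sum_mono mult_left_mono) auto
  then show ?thesis using assms(2) by simp
qed

text \<open>
  The defect \<open>1 - K h\<close> is a sum of nonnegative terms \<open>a\<^sub>l (1 - cos (\<omega>\<^sub>l h))\<close>, so it vanishes only
  termwise.
\<close>

lemma rotary_kernel_eq_1_iff:
  assumes "\<And>l. l < r \<Longrightarrow> 0 \<le> a l" and "(\<Sum>l<r. a l) = 1"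
  shows "rotary_kernel r \<omega> a h = 1 \<longleftrightarrow> (\<forall>l<r. 0 < a l \<longrightarrow> \<omega> l * h \<in> two_pi_ints)"
proof -
  have "1 - rotary_kernel r \<omega> a h = (\<Sum>l<r. a l * (1 - cos (\<omega> l * h)))"
    using assms(2) by (simp add: rotary_kernel_def right_diff_distrib sum_subtractf)
  then have "rotary_kernel r \<omega> a h = 1 \<longleftrightarrow> (\<Sum>l<r. a l * (1 - cos (\<omega> l * h))) = 0"
    by linarith
  also have "\<dots> \<longleftrightarrow> (\<forall>l<r. a l * (1 - cos (\<omega> l * h)) = 0)"
    using assms(1) by (subst sum_nonneg_eq_0_iff) auto
  also have "\<dots> \<longleftrightarrow> (\<forall>l<r. 0 < a l \<longrightarrow> \<omega> l * h \<in> two_pi_ints)"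
    using assms(1) by (auto simp: less_le simp flip: cos_eq_1_iff_two_pi_ints)
  finally show ?thesis .
qed

section \<open>The spectral gap\<close>

theorem theorem5p2:
  fixes n r :: nat and \<beta> :: real and p \<omega> a :: "nat \<Rightarrow> real"
  assumes "n \<ge> 2" and "r \<ge> 1" and "\<beta> \<ge> 0"
    and "\<And>l. l < r \<Longrightarrow> a l \<ge> 0"
    and "(\<Sum>l<r. a l) = 1"
  defines "A \<equiv> attention_matrix n r \<beta> p \<omega> a"
  defines "\<gamma> \<equiv> spectral_gap A"
  shows "complex_spectrum A \<subseteq> complex_of_real ` {0..1}
    \<and> 0 < \<gamma> \<and> \<gamma> \<le> 1
    \<and> (\<beta> = 0 \<longrightarrow> \<gamma> = 1)
    \<and> (\<beta> > 0 \<longrightarrow>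
         (\<gamma> = 1 \<longleftrightarrow>
           (\<forall>l<r. a l > 0 \<longrightarrow> (\<forall>i<n. \<forall>j<n. \<omega> l * (p i - p j) \<in> two_pi_ints))))
    \<and> (\<beta> > 0 \<and>
         (\<exists>l<r. a l > 0 \<and> (\<exists>i<n. \<exists>j<n. \<omega> l * (p i - p j) \<notin> two_pi_ints))
         \<longrightarrow> 0 < \<gamma> \<and> \<gamma> < 1)"
proof -
  let ?K = "rotary_kernel r \<omega> a" and ?W = "attention_weight r \<beta> p \<omega> a"
  have even: "?K (- h) = ?K h" for h by (simp add: rotary_kernel_def)
  interpret W: psd_weights n ?W
  proof
    show "2 \<le> n" by (fact assms(1))
    show "0 < ?W i j" for i j by (simp add: attention_weight_def)
    show "?W i j = ?W j i" for i j
      using even[of "p i - p j"] by (simp add: attention_weight_def)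
    show "0 \<le> (\<Sum>i<n. \<Sum>j<n. x i * x j * ?W i j)" for x
      using assms(3,4) by (intro attention_weight_psd)
  qed
  have A: "A = W.A"
    by (simp add: A_def attention_matrix_def W.A_def W.row_sum_def)
  have diag: "?W i i = exp \<beta>" for i
    using assms(5) by (simp add: attention_weight_def rotary_kernel_def)
  have le: "?W i j \<le> ?W i i" for i j
    using mult_left_mono[OF rotary_kernel_le_1[OF assms(4,5)] assms(3)]
    unfolding diag by (simp add: attention_weight_def)
  \<comment> \<open>Constant rows of \<open>W\<close> mean \<open>\<beta> K = \<beta>\<close>; this equation covers \<open>\<beta> = 0\<close> and \<open>\<beta> > 0\<close> at once.\<close>
  have gap_eq_1: "\<gamma> = 1 \<longleftrightarrow> (\<forall>i<n. \<forall>j<n. \<beta> * ?K (p i - p j) = \<beta>)"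
    using W.second_eigenvalue_eq_0_iff[OF le]
    unfolding \<gamma>_def spectral_gap_def A diag by (simp add: attention_weight_def)
  have invisible: "\<gamma> = 1 \<longleftrightarrow>
      (\<forall>l<r. a l > 0 \<longrightarrow> (\<forall>i<n. \<forall>j<n. \<omega> l * (p i - p j) \<in> two_pi_ints))" if "\<beta> > 0"
    unfolding gap_eq_1 using that rotary_kernel_eq_1_iff[OF assms(4,5)] by auto
  have bounds: "0 < \<gamma>" "\<gamma> \<le> 1"
    using W.second_eigenvalue_bounds by (simp_all add: \<gamma>_def spectral_gap_def A)
  have "\<gamma> = 1" if "\<beta> = 0" using that gap_eq_1 by simp
  moreover have "\<gamma> < 1"
    if "\<beta> > 0" "\<exists>l<r. a l > 0 \<and> (\<exists>i<n. \<exists>j<n. \<omega> l * (p i - p j) \<notin> two_pi_ints)"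
    using that invisible bounds by (metis less_le)
  ultimately show ?thesis
    using W.complex_spectrum_subset bounds invisible unfolding A by blast
qed

end
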